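(* Let $d_1,d_2\in\mathbb{N}$ and $\Phi\in\mathrm{UEB}(d_1,d_2)$. The following conditions are equivalent: (i) $\Phi$ is a $C^*$-extreme point of $\mathrm{UEB}(d_1,d_2)$. (ii) If $\Psi:M_{d_1}\to M_{d_2}$ is any EB-map with $\Psi\le_{EB}\Phi$ and $\Psi(I)$ invertible, then there exists an invertible matrix $Z\in M_{d_2}$ such that $\Psi=\mathrm{Ad}_Z\circ\Phi$.
   Context: $M_d$ is the algebra of complex $d\times d$ matrices; $\mathrm{Ad}_V(X)=V^*XV$; $I$ is the identity matrix. A positive semidefinite matrix $X\in M_k\otimes M_{d}$ is separable if $X=\sum_{i=1}^nA_i\otimes B_i$ with $A_i\in M_k$, $B_i\in M_d$ positive semidefinite. A completely positive map $\Phi:M_{d_1}\to M_{d_2}$ is entanglement breaking (an EB-map) if for every $k\ge1$ and every positive semidefinite $X\in M_k\otimes M_{d_1}$ the matrix $(\mathrm{id}_k\otimes\Phi)(X)$ is separable. $\mathrm{UEB}(d_1,d_2)$ is the set of all unital EB-maps $M_{d_1}\to M_{d_2}$. For EB-maps $\Phi,\Psi$, $\Psi\le_{EB}\Phi$ means that $\Phi-\Psi$ is an EB-map. $\Phi\in\mathrm{UEB}(d_1,d_2)$ is a $C^*$-extreme point of $\mathrm{UEB}(d_1,d_2)$ if, whenever $\Phi=\sum_{i=1}^n\mathrm{Ad}_{T_i}\circ\Phi_i$ with $T_i\in M_{d_2}$ invertible, $\sum_{i=1}^nT_i^*T_i=I_{d_2}$ and $\Phi_i\in\mathrm{UEB}(d_1,d_2)$,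 then there exist unitaries $U_i\in M_{d_2}$ such that $\Phi_i=\mathrm{Ad}_{U_i}\circ\Phi$ for all $1\le i\le n$. *)

theory Defs
  imports "Jordan_Normal_Form.Schur_Decomposition"
begin

text \<open>
  The algebra of complex d by d matrices is \<open>carrier_mat d d\<close>. A map between two such algebras is a
  function of type \<open>complex mat \<Rightarrow> complex mat\<close> of which only the values on the carrier are
  meaningful, so equality of maps is always stated pointwise on the carrier.
\<close>

definition psd_mat :: "nat \<Rightarrow> complex mat \<Rightarrow> bool" where
  "psd_mat n A \<longleftrightarrow> A \<in> carrier_mat n n \<and> mat_adjoint A = A \<and>
     (\<forall>v \<in> carrier_vec n. 0 \<le> (A *\<^sub>v v) \<bullet>c v)"

definition unitary_mat :: "nat \<Rightarrow> complex mat \<Rightarrow> bool" where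
  "unitary_mat n U \<longleftrightarrow> U \<in> carrier_mat n n \<and> mat_adjoint U * U = 1\<^sub>m n \<and> U * mat_adjoint U = 1\<^sub>m n"

definition Ad :: "complex mat \<Rightarrow> complex mat \<Rightarrow> complex mat" where
  "Ad V X = mat_adjoint V * X * V"

abbreviation msum :: "nat \<Rightarrow> ('i \<Rightarrow> complex mat) \<Rightarrow> 'i set \<Rightarrow> complex mat" where
  "msum n \<equiv> finsum (module_mat TYPE(complex) n n)"

text \<open>
  The tensor product of the k by k and d by d matrix algebras is identified with
  \<open>carrier_mat (k * d) (k * d)\<close> through the Kronecker product: a matrix of size \<open>k * d\<close> is a k by k
  array of d by d blocks.
\<close>

definition kron :: "complex mat \<Rightarrow> complex mat \<Rightarrow> complex mat" where
  "kron A B = mat (dim_row A * dim_row B) (dim_col A * dim_col B)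
     (\<lambda>(p, q). A $$ (p div dim_row B, q div dim_col B) * B $$ (p mod dim_row B, q mod dim_col B))"

definition block :: "nat \<Rightarrow> complex mat \<Rightarrow> nat \<Rightarrow> nat \<Rightarrow> complex mat" where
  "block d X i j = mat d d (\<lambda>(a, b). X $$ (i * d + a, j * d + b))"

text \<open>
  The map \<open>id\<^sub>k \<otimes> \<Phi>\<close> applies \<open>\<Phi>\<close> to every block; lemma \<open>ampliation_kron\<close> below shows
  that it has the expected values on elementary tensors.
\<close>

definition ampliation ::
  "nat \<Rightarrow> nat \<Rightarrow> nat \<Rightarrow> (complex mat \<Rightarrow> complex mat) \<Rightarrow> complex mat \<Rightarrow> complex mat" where
  "ampliation k d1 d2 \<Phi> X = mat (k * d2) (k * d2)
     (\<lambda>(p, q). \<Phi> (block d1 X (p div d2) (q div d2)) $$ (p mod d2, q mod d2))"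

definition separable_mat :: "nat \<Rightarrow> nat \<Rightarrow> complex mat \<Rightarrow> bool" where
  "separable_mat k d X \<longleftrightarrow> psd_mat (k * d) X \<and>
     (\<exists>n A B. (\<forall>i<n. psd_mat k (A i) \<and> psd_mat d (B i)) \<and>
        X = msum (k * d) (\<lambda>i. kron (A i) (B i)) {..<(n::nat)})"

definition linear_mat_map :: "nat \<Rightarrow> nat \<Rightarrow> (complex mat \<Rightarrow> complex mat) \<Rightarrow> bool" where
  "linear_mat_map d1 d2 \<Phi> \<longleftrightarrow>
     (\<forall>X \<in> carrier_mat d1 d1. \<Phi> X \<in> carrier_mat d2 d2) \<and>
     (\<forall>X \<in> carrier_mat d1 d1. \<forall>Y \<in> carrier_mat d1 d1. \<Phi> (X + Y) = \<Phi> X + \<Phi> Y) \<and>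
     (\<forall>c. \<forall>X \<in> carrier_mat d1 d1. \<Phi> (c \<cdot>\<^sub>m X) = c \<cdot>\<^sub>m \<Phi> X)"

definition completely_positive :: "nat \<Rightarrow> nat \<Rightarrow> (complex mat \<Rightarrow> complex mat) \<Rightarrow> bool" where
  "completely_positive d1 d2 \<Phi> \<longleftrightarrow> linear_mat_map d1 d2 \<Phi> \<and>
     (\<forall>k\<ge>1. \<forall>X. psd_mat (k * d1) X \<longrightarrow> psd_mat (k * d2) (ampliation k d1 d2 \<Phi> X))"

definition eb_map :: "nat \<Rightarrow> nat \<Rightarrow> (complex mat \<Rightarrow> complex mat) \<Rightarrow> bool" where
  "eb_map d1 d2 \<Phi> \<longleftrightarrow> completely_positive d1 d2 \<Phi> \<and>
     (\<forall>k\<ge>1. \<forall>X. psd_mat (k * d1) X \<longrightarrow> separable_mat k d2 (ampliation k d1 d2 \<Phi> X))"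

definition UEB :: "nat \<Rightarrow> nat \<Rightarrow> (complex mat \<Rightarrow> complex mat) set" where
  "UEB d1 d2 = {\<Phi>. eb_map d1 d2 \<Phi> \<and> \<Phi> (1\<^sub>m d1) = 1\<^sub>m d2}"

definition eb_le ::
  "nat \<Rightarrow> nat \<Rightarrow> (complex mat \<Rightarrow> complex mat) \<Rightarrow> (complex mat \<Rightarrow> complex mat) \<Rightarrow> bool" where
  "eb_le d1 d2 \<Psi> \<Phi> \<longleftrightarrow> eb_map d1 d2 (\<lambda>X. \<Phi> X - \<Psi> X)"

definition cstar_extreme_UEB :: "nat \<Rightarrow> nat \<Rightarrow> (complex mat \<Rightarrow> complex mat) \<Rightarrow> bool" where
  "cstar_extreme_UEB d1 d2 \<Phi> \<longleftrightarrow> \<Phi> \<in> UEB d1 d2 \<and>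
     (\<forall>(n::nat) T \<Phi>s.
        (\<forall>i<n. T i \<in> carrier_mat d2 d2 \<and> invertible_mat (T i) \<and> \<Phi>s i \<in> UEB d1 d2) \<and>
        msum d2 (\<lambda>i. mat_adjoint (T i) * T i) {..<n} = 1\<^sub>m d2 \<and>
        (\<forall>X \<in> carrier_mat d1 d1. \<Phi> X = msum d2 (\<lambda>i. Ad (T i) (\<Phi>s i X)) {..<n})
        \<longrightarrow> (\<exists>U. \<forall>i<n. unitary_mat d2 (U i) \<and>
               (\<forall>X \<in> carrier_mat d1 d1. \<Phi>s i X = Ad (U i) (\<Phi> X))))"

lemma block_kron:
  assumes "A \<in> carrier_mat k k" "B \<in> carrier_mat d d" "i < k" "j < k"
  shows "block d (kron A B) i j = A $$ (i, j) \<cdot>\<^sub>m B"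
proof -
  have "m * d + a < k * d" if "m < k" "a < d" for m a :: nat
  proof -
    have "m * d + a < Suc m * d" using that by simp
    also have "\<dots> \<le> k * d" using that by (intro mult_le_mono1) simp
    finally show ?thesis .
  qed
  then show ?thesis
    using assms by (intro eq_matI) (auto simp: block_def kron_def)
qed

lemma ampliation_kron:
  assumes \<Phi>: "linear_mat_map d1 d2 \<Phi>" and A: "A \<in> carrier_mat k k" and B: "B \<in> carrier_mat d1 d1"
  shows "ampliation k d1 d2 \<Phi> (kron A B) = kron A (\<Phi> B)"
proof -
  have \<Phi>B: "\<Phi> B \<in> carrier_mat d2 d2"
    using \<Phi> B by (auto simp: linear_mat_map_def)
  show ?thesis
  proof (intro eq_matI)
    fix p q assume "p < dim_row (kron A (\<Phi> B))" "q < dim_col (kron A (\<Phi> B))"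
    then have pq: "p < k * d2" "q < k * d2" using A \<Phi>B by (auto simp: kron_def)
    then have d2: "0 < d2" by (cases d2) auto
    have lt: "p div d2 < k" "q div d2 < k"
      using pq by (auto simp: less_mult_imp_div_less)
    show "ampliation k d1 d2 \<Phi> (kron A B) $$ (p, q) = kron A (\<Phi> B) $$ (p, q)"
      using pq lt d2 A B \<Phi>B \<Phi> block_kron[OF A B lt]
      by (auto simp: ampliation_def kron_def linear_mat_map_def)
  qed (use A \<Phi>B in \<open>auto simp: ampliation_def kron_def\<close>)
qed

lemma msum_carrier_and_index:
  assumes "finite I" "\<And>i. i \<in> I \<Longrightarrow> f i \<in> carrier_mat n n"
  shows "msum n f I \<in> carrier_mat n n \<and> (\<forall>p<n. \<forall>q<n. msum n f I $$ (p, q) = (\<Sum>i\<in>I. f i $$ (p, q)))"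
proof -
  interpret M: abelian_monoid "module_mat TYPE(complex) n n"
    by (rule abelian_group.axioms(1)[OF abelian_group_mat])
  show ?thesis using assms
    by (induction I rule: finite_induct) (auto simp: Pi_def module_mat_simps)
qed

end

theory Submission
  imports Defs
begin

text \<open>
  Both implications compare a decomposition \<open>\<Phi> = \<Sum>\<^sub>i Ad\<^bsub>T\<^sub>i\<^esub> \<circ> \<Phi>\<^sub>i\<close> with its
  summands, which are EB-maps dominated by \<open>\<Phi>\<close>.

  A dominated map is always a summand, up to a scalar. The complement \<open>\<Phi> - \<Psi>\<close> of a dominated
  \<open>\<Psi>\<close> need not have an invertible value at the identity, but the complement of \<open>\<Psi>/2\<close> does:
  \<open>\<Phi> - \<Psi>/2 = \<Phi>/2 + (\<Phi> - \<Psi>)/2\<close> takes there the value \<open>I/2\<close> plus a positive semidefinite matrix.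
  Any EB-map \<open>\<Theta>\<close> with \<open>\<Theta>(I)\<close> invertible is \<open>Ad\<^bsub>T\<^esub> \<circ> \<Phi>'\<close> with \<open>T\<close> invertible and \<open>\<Phi>'\<close> a
  unital EB-map, because \<open>\<Theta>(I) = T\<^sup>*T\<close> for some \<open>T\<close> (lemma \<open>eb_map_normalize\<close>). Applied to \<open>\<Psi>/2\<close>
  and to its complement, this gives a two-term decomposition of \<open>\<Phi>\<close>. If \<open>\<Phi>\<close> is extreme, the first
  term is \<open>Ad\<^bsub>T\<^esub> \<circ> Ad\<^bsub>U\<^esub> \<circ> \<Phi>\<close> with \<open>U\<close> unitary, so \<open>\<Psi>\<close> is the conjugate of \<open>\<Phi>\<close> by
  \<open>\<surd>2 U T\<close>.

  Conversely, the summand \<open>Ad\<^bsub>T\<^sub>i\<^esub> \<circ> \<Phi>\<^sub>i\<close> of a decomposition is dominated by \<open>\<Phi>\<close>, hence equal to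
  \<open>Ad\<^bsub>Z\<^esub> \<circ> \<Phi>\<close>. Evaluation at the identity yields \<open>Z\<^sup>*Z = T\<^sub>i\<^sup>*T\<^sub>i\<close>, which says exactly that
  \<open>U\<^sub>i = Z T\<^sub>i\<^sup>-\<^sup>1\<close> is unitary, and \<open>\<Phi>\<^sub>i = Ad\<^bsub>U\<^sub>i\<^esub> \<circ> \<Phi>\<close>.

  Two ingredients carry these arguments: the factorization \<open>A = T\<^sup>*T\<close> of a positive semidefinite
  matrix, obtained here by symmetric Gaussian elimination (lemma \<open>psd_kernel_factorization\<close>), and the
  stability of EB-maps under sums and under conjugation of their values (lemmas \<open>eb_map_add\<close> and
  \<open>eb_map_Ad\<close>).
\<close>

section \<open>Adjoints and conjugations\<close>

lemma mat_adjoint_dim [simp]: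
  "dim_row (mat_adjoint A) = dim_col A" "dim_col (mat_adjoint A) = dim_row A"
  by (auto simp: mat_adjoint_def)

lemma mat_adjoint_carrier [simp]:
  "A \<in> carrier_mat n m \<Longrightarrow> mat_adjoint A \<in> carrier_mat m n"
  by (rule carrier_matI) simp_all

lemma mat_adjoint_index [simp]:
  assumes "i < dim_col A" "j < dim_row A"
  shows "mat_adjoint A $$ (i, j) = conjugate (A $$ (j, i))"
  using assms by (simp add: mat_adjoint_def mat_of_rows_index)

lemma mat_adjoint_adjoint [simp]: "mat_adjoint (mat_adjoint A) = A"
  by (intro eq_matI) auto

lemma mat_adjoint_mult:
  fixes A B :: "complex mat"
  assumes "A \<in> carrier_mat n m" "B \<in> carrier_mat m l"
  shows "mat_adjoint (A * B) = mat_adjoint B * mat_adjoint A"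
  using assms by (intro eq_matI) (auto simp: scalar_prod_def intro!: sum.cong)

lemma mat_adjoint_one [simp]: "mat_adjoint (1\<^sub>m n :: complex mat) = 1\<^sub>m n"
  by (intro eq_matI) auto

lemma mat_adjoint_add:
  fixes A B :: "complex mat"
  assumes "A \<in> carrier_mat n n" "B \<in> carrier_mat n n"
  shows "mat_adjoint (A + B) = mat_adjoint A + mat_adjoint B"
  using assms by (intro eq_matI) auto

lemma mat_adjoint_smult:
  "mat_adjoint (c \<cdot>\<^sub>m A) = cnj c \<cdot>\<^sub>m mat_adjoint (A :: complex mat)"
  by (intro eq_matI) auto

lemma mat_adjoint_cscalar_prod:
  fixes V :: "complex mat"
  assumes V: "V \<in> carrier_mat n m" and u: "u \<in> carrier_vec n" and v: "v \<in> carrier_vec m"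
  shows "(mat_adjoint V *\<^sub>v u) \<bullet>c v = u \<bullet>c (V *\<^sub>v v)"
proof -
  have "(mat_adjoint V *\<^sub>v u) \<bullet>c v = (\<Sum>i<m. \<Sum>j<n. cnj (V $$ (j, i)) * u $ j * cnj (v $ i))"
    using assms by (auto simp: scalar_prod_def sum_distrib_right lessThan_atLeast0 intro!: sum.cong)
  also have "\<dots> = (\<Sum>j<n. \<Sum>i<m. cnj (V $$ (j, i)) * u $ j * cnj (v $ i))"
    by (rule sum.swap)
  also have "\<dots> = u \<bullet>c (V *\<^sub>v v)"
    using assms
    by (auto simp: scalar_prod_def sum_distrib_left lessThan_atLeast0 mult_ac intro!: sum.cong)
  finally show ?thesis .
qed

lemma smult_smult_mat: "a \<cdot>\<^sub>m (b \<cdot>\<^sub>m A) = (a * b) \<cdot>\<^sub>m (A :: complex mat)"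
  by (intro eq_matI) (auto simp: mult.assoc)

lemma Ad_carrier [simp]:
  "V \<in> carrier_mat n n \<Longrightarrow> X \<in> carrier_mat n n \<Longrightarrow> Ad V X \<in> carrier_mat n n"
  by (auto simp: Ad_def)

lemma Ad_add:
  assumes V: "V \<in> carrier_mat n n" and X: "X \<in> carrier_mat n n" and Y: "Y \<in> carrier_mat n n"
  shows "Ad V (X + Y) = Ad V X + Ad V Y"
proof -
  note V' = mat_adjoint_carrier[OF V]
  show ?thesis
    unfolding Ad_def mult_add_distrib_mat[OF V' X Y]
    by (rule add_mult_distrib_mat[OF mult_carrier_mat[OF V' X] mult_carrier_mat[OF V' Y] V])
qed

lemma Ad_scale:
  assumes V: "V \<in> carrier_mat n n" and X: "X \<in> carrier_mat n n"
  shows "Ad V (c \<cdot>\<^sub>m X) = c \<cdot>\<^sub>m Ad V X"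
proof -
  note V' = mat_adjoint_carrier[OF V]
  show ?thesis
    unfolding Ad_def mult_smult_distrib[OF V' X]
    by (rule mult_smult_assoc_mat[OF mult_carrier_mat[OF V' X] V])
qed

lemma linear_mat_map_Ad: "V \<in> carrier_mat n n \<Longrightarrow> linear_mat_map n n (Ad V)"
  unfolding linear_mat_map_def by (simp add: Ad_add Ad_scale)

lemma Ad_Ad:
  assumes S: "S \<in> carrier_mat n n" and T: "T \<in> carrier_mat n n" and X: "X \<in> carrier_mat n n"
  shows "Ad S (Ad T X) = Ad (T * S) X"
proof -
  note S' = mat_adjoint_carrier[OF S] and T' = mat_adjoint_carrier[OF T]
  have "Ad S (Ad T X) = mat_adjoint S * (mat_adjoint T * X * (T * S))"
    unfolding Ad_def
    by (simp only: assoc_mult_mat[OF S' mult_carrier_mat[OF mult_carrier_mat[OF T' X] T] S]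
        assoc_mult_mat[OF mult_carrier_mat[OF T' X] T S])
  also have "\<dots> = Ad (T * S) X"
    unfolding Ad_def mat_adjoint_mult[OF T S] assoc_mult_mat[OF S' T' X]
    by (rule assoc_mult_mat[OF S' mult_carrier_mat[OF T' X] mult_carrier_mat[OF T S], symmetric])
  finally show ?thesis .
qed

lemma Ad_one [simp]: "X \<in> carrier_mat n n \<Longrightarrow> Ad (1\<^sub>m n) X = X"
  by (simp add: Ad_def)

lemma Ad_of_one: "V \<in> carrier_mat n n \<Longrightarrow> Ad V (1\<^sub>m n) = mat_adjoint V * V"
  by (simp add: Ad_def)

lemma Ad_smult:
  assumes V: "V \<in> carrier_mat n n" and X: "X \<in> carrier_mat n n"
  shows "Ad (c \<cdot>\<^sub>m V) X = (c * cnj c) \<cdot>\<^sub>m Ad V X"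
proof -
  note V' = mat_adjoint_carrier[OF V]
  show ?thesis
    unfolding Ad_def mat_adjoint_smult mult_smult_assoc_mat[OF V' X]
      mult_smult_assoc_mat[OF mult_carrier_mat[OF V' X] smult_carrier_mat[OF V]]
      mult_smult_distrib[OF mult_carrier_mat[OF V' X] V]
    by (simp add: smult_smult_mat mult.commute)
qed

lemma Ad_index:
  assumes "V \<in> carrier_mat n n" "X \<in> carrier_mat n n" "p < n" "q < n"
  shows "Ad V X $$ (p, q) = (\<Sum>s<n. (\<Sum>r<n. cnj (V $$ (r, p)) * X $$ (r, s)) * V $$ (s, q))"
  using assms by (auto simp: Ad_def scalar_prod_def lessThan_atLeast0 intro!: sum.cong)

section \<open>Invertible and positive semidefinite matrices\<close>

lemma invertible_matD:
  assumes "invertible_mat T" "T \<in> carrier_mat n n"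
  obtains S where "S \<in> carrier_mat n n" "S * T = 1\<^sub>m n" "T * S = 1\<^sub>m n"
proof -
  obtain S where S: "T * S = 1\<^sub>m n" "S * T = 1\<^sub>m (dim_row S)"
    using assms by (auto simp: invertible_mat_def inverts_mat_def)
  then have "dim_col S = n" "dim_row S = n"
    using assms(2) by (metis index_mult_mat(3) index_one_mat(3), metis carrier_matD(2) index_mult_mat(3) index_one_mat(3))
  with S that show ?thesis by auto
qed

lemma invertible_matI:
  fixes S T :: "complex mat"
  assumes "S \<in> carrier_mat n n" "T \<in> carrier_mat n n" "S * T = 1\<^sub>m n"
  shows "invertible_mat T"
  using assms mat_mult_left_right_inverse[OF assms]
  by (auto simp: invertible_mat_def inverts_mat_def)

lemma invertible_mat_mult:
  fixes S T :: "complex mat"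
  assumes S: "S \<in> carrier_mat n n" "invertible_mat S" and T: "T \<in> carrier_mat n n" "invertible_mat T"
  shows "invertible_mat (S * T)"
proof -
  obtain S' where S': "S' \<in> carrier_mat n n" "S' * S = 1\<^sub>m n" using invertible_matD S by metis
  obtain T' where T': "T' \<in> carrier_mat n n" "T' * T = 1\<^sub>m n" using invertible_matD T by metis
  have "S' * (S * T) = (S' * S) * T" by (rule assoc_mult_mat[OF S'(1) S(1) T(1), symmetric])
  then have "S' * (S * T) = T" using S'(2) T(1) by simp
  then have "(T' * S') * (S * T) = 1\<^sub>m n"
    using assoc_mult_mat[OF T'(1) S'(1) mult_carrier_mat[OF S(1) T(1)]] T'(2) by simp
  then show ?thesis using S(1) T(1) S'(1) T'(1) by (intro invertible_matI[of "T' * S'" n]) auto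
qed

lemma invertible_mat_smult:
  fixes T :: "complex mat"
  assumes T: "T \<in> carrier_mat n n" "invertible_mat T" and c: "c \<noteq> 0"
  shows "invertible_mat (c \<cdot>\<^sub>m T)"
proof -
  obtain S where S: "S \<in> carrier_mat n n" "S * T = 1\<^sub>m n" using invertible_matD T by metis
  have "((1 / c) \<cdot>\<^sub>m S) * (c \<cdot>\<^sub>m T) = (1 / c) \<cdot>\<^sub>m (c \<cdot>\<^sub>m (S * T))"
    by (simp only: mult_smult_assoc_mat[OF S(1) smult_carrier_mat[OF T(1)]]
        mult_smult_distrib[OF S(1) T(1)])
  also have "\<dots> = 1\<^sub>m n" using S(2) c by (simp add: smult_smult_mat) (auto intro!: eq_matI)
  finally show ?thesis using T(1) S(1) by (intro invertible_matI[of "(1 / c) \<cdot>\<^sub>m S" n]) auto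
qed

lemma psd_mat_Ad:
  assumes V: "V \<in> carrier_mat n n" and A: "psd_mat n A"
  shows "psd_mat n (Ad V A)"
proof -
  have A': "A \<in> carrier_mat n n" "mat_adjoint A = A" using A by (auto simp: psd_mat_def)
  note V' = mat_adjoint_carrier[OF V]
  have "mat_adjoint (Ad V A) = Ad V A"
    unfolding Ad_def mat_adjoint_mult[OF mult_carrier_mat[OF V' A'(1)] V] mat_adjoint_mult[OF V' A'(1)]
    by (simp add: A'(2) assoc_mult_mat[OF V' A'(1) V])
  moreover have "0 \<le> (Ad V A *\<^sub>v v) \<bullet>c v" if v: "v \<in> carrier_vec n" for v
  proof -
    have "(Ad V A *\<^sub>v v) \<bullet>c v = (mat_adjoint V *\<^sub>v (A *\<^sub>v (V *\<^sub>v v))) \<bullet>c v"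
      unfolding Ad_def assoc_mult_mat_vec[OF mult_carrier_mat[OF V' A'(1)] V v]
        assoc_mult_mat_vec[OF V' A'(1) mult_mat_vec_carrier[OF V v]] ..
    also have "\<dots> = (A *\<^sub>v (V *\<^sub>v v)) \<bullet>c (V *\<^sub>v v)"
      using V A' v by (intro mat_adjoint_cscalar_prod[of _ n n]) auto
    also have "0 \<le> \<dots>" using V A v by (auto simp: psd_mat_def)
    finally show ?thesis .
  qed
  ultimately show ?thesis using V A' by (auto simp: psd_mat_def)
qed

lemma psd_mat_add:
  assumes A: "psd_mat n A" and B: "psd_mat n B"
  shows "psd_mat n (A + B)"
proof -
  have c: "A \<in> carrier_mat n n" "B \<in> carrier_mat n n" using A B by (auto simp: psd_mat_def)
  have "0 \<le> ((A + B) *\<^sub>v v) \<bullet>c v" if v: "v \<in> carrier_vec n" for v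
  proof -
    have "((A + B) *\<^sub>v v) \<bullet>c v = (A *\<^sub>v v) \<bullet>c v + (B *\<^sub>v v) \<bullet>c v"
      using c v by (simp add: add_mult_distrib_mat_vec[OF c v] add_scalar_prod_distrib[of _ n])
    then show ?thesis using A B v by (simp add: psd_mat_def)
  qed
  then show ?thesis using A B c mat_adjoint_add[OF c] by (auto simp: psd_mat_def)
qed

lemma psd_mat_zero: "psd_mat n (0\<^sub>m n n)"
proof -
  have "mat_adjoint (0\<^sub>m n n) = (0\<^sub>m n n :: complex mat)" by (intro eq_matI) auto
  moreover have "0\<^sub>m n n *\<^sub>v v = (0\<^sub>v n :: complex vec)" if "v \<in> carrier_vec n" for v
    using that by (intro eq_vecI) auto
  ultimately show ?thesis by (simp add: psd_mat_def)
qed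

lemma psd_mat_one: "psd_mat n (1\<^sub>m n)"
  by (auto simp: psd_mat_def)

lemma invertible_scalar_plus_psd:
  assumes A: "psd_mat n A" and c: "0 < c"
  shows "invertible_mat (complex_of_real c \<cdot>\<^sub>m 1\<^sub>m n + A)" (is "invertible_mat ?B")
proof -
  have A': "A \<in> carrier_mat n n" using A by (auto simp: psd_mat_def)
  have "det ?B \<noteq> 0"
  proof
    assume "det ?B = 0"
    then obtain v where v: "v \<in> carrier_vec n" "v \<noteq> 0\<^sub>v n" "?B *\<^sub>v v = 0\<^sub>v n"
      using A' det_0_iff_vec_prod_zero[of ?B n] by auto
    have "(?B *\<^sub>v v) \<bullet>c v = c * (v \<bullet>c v) + (A *\<^sub>v v) \<bullet>c v"
    proof -
      have "complex_of_real c \<cdot>\<^sub>m 1\<^sub>m n *\<^sub>v v = complex_of_real c \<cdot>\<^sub>v v"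
        using v(1) by (intro eq_vecI) auto
      then show ?thesis
        using A' v(1)
        by (simp add: add_mult_distrib_mat_vec[of _ n n] add_scalar_prod_distrib[of _ n])
    qed
    moreover have "0 \<le> (A *\<^sub>v v) \<bullet>c v" using A v by (auto simp: psd_mat_def)
    moreover have pos: "0 < v \<bullet>c v" using v by simp
    ultimately have "c * Re (v \<bullet>c v) + Re ((A *\<^sub>v v) \<bullet>c v) = 0" "0 \<le> Re ((A *\<^sub>v v) \<bullet>c v)"
      using v by (auto simp: less_complex_def less_eq_complex_def complex_eq_iff)
    moreover have "0 < c * Re (v \<bullet>c v)" using pos c by (simp add: less_complex_def)
    ultimately show False by linarith
  qed
  then obtain S where "S \<in> carrier_mat n n" "S * ?B = 1\<^sub>m n"
    using det_non_zero_imp_unit[of ?B n "()"] A' by (auto simp: Units_def ring_mat_def)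
  then show ?thesis using A' by (intro invertible_matI[of S n]) auto
qed

text \<open>
  This is the Cholesky factorization, proved by eliminating the last index: the Schur complement
  \<open>b i j = a i j - a i n * a n j / a n n\<close> is again positive semidefinite, since its value at \<open>v\<close> is the
  value of the form of \<open>a\<close> at \<open>v\<close> extended by the minimizing last coordinate. The statement is about
  functions on index pairs, so that the size can vary in the induction.
\<close>

lemma psd_kernel_factorization:
  fixes a :: "nat \<Rightarrow> nat \<Rightarrow> complex"
  assumes "\<forall>i<n. \<forall>j<n. a j i = cnj (a i j)"
    and "\<And>v. 0 \<le> (\<Sum>i<n. \<Sum>j<n. cnj (v i) * a i j * v j)"
  shows "\<exists>t. \<forall>i<n. \<forall>j<n. a i j = (\<Sum>k<n. cnj (t k i) * t k j)"
  using assms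
proof (induction n arbitrary: a)
  case 0
  then show ?case by simp
next
  case (Suc n)
  define \<alpha> where "\<alpha> = a n n"
  define Q where "Q v = (\<Sum>i<n. \<Sum>j<n. cnj (v i) * a i j * v j)" for v
  define s where "s v = (\<Sum>j<n. a n j * v j)" for v
  have herm: "a j i = cnj (a i j)" if "i \<le> n" "j \<le> n" for i j
    using Suc.prems(1) that le_imp_less_Suc by blast
  have cs: "(\<Sum>i<n. cnj (v i) * a i n) = cnj (s v)" for v
  proof -
    have "cnj (v i) * a i n = cnj (a n i * v i)" if "i < n" for i
      using herm[of n i] that by (simp add: mult.commute)
    then show ?thesis unfolding s_def cnj_sum by (intro sum.cong) auto
  qed
  have form: "0 \<le> Q v + cnj x * s v + cnj (s v) * x + cnj x * \<alpha> * x" for v x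
  proof -
    let ?w = "\<lambda>i. if i = n then x else v i"
    have "(\<Sum>i<Suc n. \<Sum>j<Suc n. cnj (?w i) * a i j * ?w j)
        = (\<Sum>i<n. (\<Sum>j<n. cnj (v i) * a i j * v j) + cnj (v i) * a i n * x)
          + ((\<Sum>j<n. cnj x * a n j * v j) + cnj x * \<alpha> * x)"
      by (simp add: \<alpha>_def)
    also have "\<dots> = Q v + (\<Sum>i<n. cnj (v i) * a i n) * x + cnj x * s v + cnj x * \<alpha> * x"
      by (simp add: Q_def s_def sum.distrib sum_distrib_left sum_distrib_right mult.assoc)
    finally show ?thesis using Suc.prems(2)[of ?w] by (simp add: cs algebra_simps)
  qed
  have \<alpha>: "0 \<le> \<alpha>" using form[of "\<lambda>_. 0" 1] by (simp add: Q_def s_def)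
  then have \<alpha>_real: "\<alpha> = of_real (Re \<alpha>)" "0 \<le> Re \<alpha>" "cnj \<alpha> = \<alpha>"
    by (auto simp: less_eq_complex_def complex_eq_iff)
  have degenerate: "a n j = 0" if "\<alpha> = 0" "j < n" for j
  proof (rule ccontr)
    assume nz: "a n j \<noteq> 0"
    define v where "v = (\<lambda>i. if i = j then 1 else 0 :: complex)"
    define z where "z = a n j"
    have sv: "s v = z" using that by (simp add: s_def v_def z_def if_distrib[of "\<lambda>y. _ * y"] cong: if_cong)
    \<comment> \<open>Without the quadratic term the form is affine along the ray \<open>x = - r z\<close>; this \<open>r\<close> makes it
      take the value \<open>-1\<close>.\<close>
    define r where "r = (Re (Q v) + 1) / (2 * (cmod z)\<^sup>2)"
    have "0 \<le> Re (Q v + cnj (- of_real r * z) * z + cnj z * (- of_real r * z))"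
      using form[of v "- of_real r * z"] that(1) sv by (simp add: less_eq_complex_def)
    also have "\<dots> = Re (Q v) - 2 * r * (cmod z)\<^sup>2"
    proof -
      have "(cmod z)\<^sup>2 = Re z * Re z + Im z * Im z"
        unfolding cmod_power2 by (simp only: power2_eq_square)
      then show ?thesis by (simp add: algebra_simps)
    qed
    also have "\<dots> = - 1" using nz by (simp add: r_def z_def field_simps)
    finally show False by simp
  qed
  define b where "b i j = a i j - cnj (a n i) * a n j / \<alpha>" for i j
  have "\<exists>t. \<forall>i<n. \<forall>j<n. b i j = (\<Sum>k<n. cnj (t k i) * t k j)"
  proof (rule Suc.IH)
    show "\<forall>i<n. \<forall>j<n. b j i = cnj (b i j)"
    proof (intro allI impI)
      fix i j assume "i < n" "j < n"
      then have "a j i = cnj (a i j)" by (intro herm) auto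
      then show "b j i = cnj (b i j)" using \<alpha>_real(3) by (simp add: b_def mult.commute)
    qed
  next
    fix v
    have "(\<Sum>i<n. \<Sum>j<n. cnj (v i) * b i j * v j)
        = Q v - (\<Sum>i<n. \<Sum>j<n. (cnj (a n i) * cnj (v i)) * (a n j * v j)) / \<alpha>"
      by (simp add: b_def Q_def sum_subtractf sum_divide_distrib algebra_simps)
    also have "(\<Sum>i<n. \<Sum>j<n. (cnj (a n i) * cnj (v i)) * (a n j * v j)) = cnj (s v) * s v"
      by (simp add: s_def cnj_sum sum_product)
    \<comment> \<open>The minimizing last coordinate is \<open>x = - s v / \<alpha>\<close>. If \<open>\<alpha> = 0\<close>, then \<open>x = 0\<close> by the convention
      on division by zero, and the equation still holds.\<close>
    also have "Q v - cnj (s v) * s v / \<alpha>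
        = Q v + cnj (- s v / \<alpha>) * s v + cnj (s v) * (- s v / \<alpha>) + cnj (- s v / \<alpha>) * \<alpha> * (- s v / \<alpha>)"
      using \<alpha>_real(3) by (cases "\<alpha> = 0") (auto simp: field_simps)
    also have "0 \<le> \<dots>" by (rule form)
    finally show "0 \<le> (\<Sum>i<n. \<Sum>j<n. cnj (v i) * b i j * v j)" .
  qed
  then obtain t where t: "\<And>i j. i < n \<Longrightarrow> j < n \<Longrightarrow> b i j = (\<Sum>k<n. cnj (t k i) * t k j)" by blast
  define \<beta> where "\<beta> = complex_of_real (sqrt (Re \<alpha>))"
  have "\<beta> * \<beta> = of_real (Re \<alpha>)"
    unfolding \<beta>_def of_real_mult[symmetric] using \<alpha>_real(2) by simp
  then have \<beta>: "\<beta> * \<beta> = \<alpha>" "cnj \<beta> = \<beta>"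
    using \<alpha>_real(1) by (simp_all add: \<beta>_def)
  \<comment> \<open>The factor of the Schur complement is bordered by the eliminated row divided by \<open>\<surd>\<alpha>\<close>; for \<open>\<alpha> = 0\<close>
    that row is zero.\<close>
  define t' where "t' k j = (if k < n then (if j < n then t k j else 0) else a n j / \<beta>)" for k j
  have "a i j = (\<Sum>k<Suc n. cnj (t' k i) * t' k j)" if "i \<le> n" "j \<le> n" for i j
  proof -
    have "(\<Sum>k<Suc n. cnj (t' k i) * t' k j)
        = (if i < n \<and> j < n then b i j else 0) + cnj (a n i) * a n j / \<alpha>"
      using \<beta> by (auto simp: t'_def t)
    moreover have "cnj (a n i) * a n n / \<alpha> = a i n" if "i \<le> n" for i
    proof (cases "i = n")
      case True
      then show ?thesis using \<alpha>_real(3) by (cases "\<alpha> = 0") (auto simp: \<alpha>_def)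
    next
      case False
      then have "a i n = cnj (a n i)" using herm[of n i] that by simp
      then show ?thesis using degenerate[of i] False that by (cases "\<alpha> = 0") (auto simp: \<alpha>_def)
    qed
    moreover have "cnj (a n n) * a n j / \<alpha> = a n j"
      using degenerate[of j] that \<alpha>_real(3) by (cases "\<alpha> = 0"; cases "j = n") (auto simp: \<alpha>_def)
    ultimately show ?thesis
      using that by (cases "i = n"; cases "j = n") (auto simp: b_def)
  qed
  then show ?case by (auto simp: less_Suc_eq_le intro!: exI[of _ t'])
qed

lemma psd_mat_factorization:
  assumes A: "psd_mat n A"
  obtains T where "T \<in> carrier_mat n n" "mat_adjoint T * T = A"
proof -
  have A': "A \<in> carrier_mat n n" "mat_adjoint A = A" using A by (auto simp: psd_mat_def)
  have "\<exists>t. \<forall>i<n. \<forall>j<n. A $$ (i, j) = (\<Sum>k<n. cnj (t k i) * t k j)"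
  proof (rule psd_kernel_factorization)
    show "\<forall>i<n. \<forall>j<n. A $$ (j, i) = cnj (A $$ (i, j))"
    proof (intro allI impI)
      fix i j assume "i < n" "j < n"
      then have "mat_adjoint A $$ (j, i) = cnj (A $$ (i, j))" using A'(1) by simp
      then show "A $$ (j, i) = cnj (A $$ (i, j))" using A'(2) by simp
    qed
  next
    fix v
    have "(A *\<^sub>v vec n v) \<bullet>c vec n v = (\<Sum>i<n. \<Sum>j<n. cnj (v i) * A $$ (i, j) * v j)"
      using A'(1)
      by (auto simp: scalar_prod_def lessThan_atLeast0 sum_distrib_left mult_ac intro!: sum.cong)
    then show "0 \<le> (\<Sum>i<n. \<Sum>j<n. cnj (v i) * A $$ (i, j) * v j)"
      using A by (metis psd_mat_def vec_carrier)
  qed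
  then obtain t where t: "\<And>i j. i < n \<Longrightarrow> j < n \<Longrightarrow> A $$ (i, j) = (\<Sum>k<n. cnj (t k i) * t k j)"
    by blast
  define T where "T = mat n n (\<lambda>(k, j). t k j)"
  have "mat_adjoint T * T = A"
    using A'(1) by (intro eq_matI) (auto simp: T_def t scalar_prod_def lessThan_atLeast0)
  then show ?thesis using that[of T] by (simp add: T_def)
qed

section \<open>Matrix sums\<close>

lemma msum_carrier:
  assumes "finite I" "\<And>i. i \<in> I \<Longrightarrow> f i \<in> carrier_mat n n"
  shows "msum n f I \<in> carrier_mat n n"
  using msum_carrier_and_index[of I f n] assms by blast

lemma msum_index:
  assumes "finite I" "\<And>i. i \<in> I \<Longrightarrow> f i \<in> carrier_mat n n" "p < n" "q < n"
  shows "msum n f I $$ (p, q) = (\<Sum>i\<in>I. f i $$ (p, q))"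
  using msum_carrier_and_index[of I f n] assms by blast

lemma msum_empty [simp]: "msum n f {} = 0\<^sub>m n n"
proof -
  interpret M: abelian_monoid "module_mat TYPE(complex) n n"
    by (rule abelian_group.axioms(1)[OF abelian_group_mat])
  show ?thesis by (simp add: module_mat_simps)
qed

lemma msum_insert:
  assumes "finite I" "i \<notin> I" "\<And>j. j \<in> insert i I \<Longrightarrow> f j \<in> carrier_mat n n"
  shows "msum n f (insert i I) = f i + msum n f I"
proof -
  interpret M: abelian_monoid "module_mat TYPE(complex) n n"
    by (rule abelian_group.axioms(1)[OF abelian_group_mat])
  show ?thesis using assms by (subst M.finsum_insert) (auto simp: Pi_def module_mat_simps)
qed

lemma msum_cong:
  assumes "finite I" "\<And>i. i \<in> I \<Longrightarrow> g i \<in> carrier_mat n n" "\<And>i. i \<in> I \<Longrightarrow> f i = g i"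
  shows "msum n f I = msum n g I"
proof -
  have f: "\<And>i. i \<in> I \<Longrightarrow> f i \<in> carrier_mat n n" using assms by simp
  show ?thesis
    using msum_carrier[OF assms(1), of f n] msum_carrier[OF assms(1), of g n] assms f
    by (intro eq_matI) (auto simp: msum_index)
qed

lemma linear_mat_mapD:
  assumes "linear_mat_map n m L" "X \<in> carrier_mat n n"
  shows "L X \<in> carrier_mat m m"
    and "Y \<in> carrier_mat n n \<Longrightarrow> L (X + Y) = L X + L Y"
    and "L (c \<cdot>\<^sub>m X) = c \<cdot>\<^sub>m L X"
  using assms by (auto simp: linear_mat_map_def)

lemma linear_mat_map_zero:
  assumes L: "linear_mat_map n m L"
  shows "L (0\<^sub>m n n) = 0\<^sub>m m m"
proof -
  have zero: "0 \<cdot>\<^sub>m Y = 0\<^sub>m k k" if "Y \<in> carrier_mat k k" for Y :: "complex mat" and k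
    using that by (intro eq_matI) auto
  have "L (0 \<cdot>\<^sub>m 0\<^sub>m n n) = 0 \<cdot>\<^sub>m L (0\<^sub>m n n)"
    by (rule linear_mat_mapD(3)[OF L]) simp
  then show ?thesis
    using linear_mat_mapD(1)[OF L, of "0\<^sub>m n n"] by (simp add: zero)
qed

lemma linear_mat_map_msum:
  assumes L: "linear_mat_map n m L" and "finite I" "\<And>i. i \<in> I \<Longrightarrow> f i \<in> carrier_mat n n"
  shows "L (msum n f I) = msum m (\<lambda>i. L (f i)) I"
  using assms(2,3)
proof (induction I rule: finite_induct)
  case empty
  then show ?case using linear_mat_map_zero[OF L] by simp
next
  case (insert i I)
  have "L (msum n f (insert i I)) = L (f i + msum n f I)"
    using insert by (subst msum_insert) auto
  also have "\<dots> = L (f i) + L (msum n f I)"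
    using insert by (intro linear_mat_mapD(2)[OF L] msum_carrier) auto
  also have "\<dots> = L (f i) + msum m (\<lambda>i. L (f i)) I" using insert by simp
  also have "\<dots> = msum m (\<lambda>i. L (f i)) (insert i I)"
    using insert linear_mat_mapD(1)[OF L] by (intro msum_insert[symmetric]) auto
  finally show ?case .
qed

section \<open>Blocks and ampliations\<close>

lemma block_index_less:
  assumes "l < k" "a < d"
  shows "l * d + a < k * (d :: nat)"
proof -
  have "l * d + a < Suc l * d" using assms by simp
  also have "\<dots> \<le> k * d" using assms by (intro mult_le_mono1) simp
  finally show ?thesis .
qed

lemma block_carrier [simp]: "block d X i j \<in> carrier_mat d d"
  by (simp add: block_def)

lemma ampliation_carrier [simp]: "ampliation k d1 d2 \<Phi> X \<in> carrier_mat (k * d2) (k * d2)"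
  by (simp add: ampliation_def)

lemma block_ampliation:
  assumes "l < k" "m < k" "\<Phi> (block d1 X l m) \<in> carrier_mat d2 d2"
  shows "block d2 (ampliation k d1 d2 \<Phi> X) l m = \<Phi> (block d1 X l m)"
  using assms by (intro eq_matI) (auto simp: block_def ampliation_def block_index_less)

lemma div_mod_block_index:
  assumes "p < k * (d :: nat)"
  shows "p div d < k" "p mod d < d"
proof -
  show "p div d < k" using assms by (simp add: less_mult_imp_div_less)
  show "p mod d < d" using assms by (cases d) auto
qed

lemma ampliation_cong:
  assumes "\<And>X. X \<in> carrier_mat d1 d1 \<Longrightarrow> \<Phi> X = \<Psi> X"
  shows "ampliation k d1 d2 \<Phi> X = ampliation k d1 d2 \<Psi> X"
  using assms by (simp add: ampliation_def)

lemma ampliation_compose: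
  assumes "\<And>X. X \<in> carrier_mat d1 d1 \<Longrightarrow> \<Phi> X \<in> carrier_mat d2 d2"
  shows "ampliation k d1 d3 (\<lambda>X. \<Psi> (\<Phi> X)) X = ampliation k d2 d3 \<Psi> (ampliation k d1 d2 \<Phi> X)"
  using assms
  by (intro eq_matI)
    (auto simp: ampliation_def[of _ _ d3] block_ampliation div_mod_block_index)

lemma ampliation_add:
  assumes "\<And>X. X \<in> carrier_mat d1 d1 \<Longrightarrow> \<Phi> X \<in> carrier_mat d2 d2"
    and "\<And>X. X \<in> carrier_mat d1 d1 \<Longrightarrow> \<Psi> X \<in> carrier_mat d2 d2"
  shows "ampliation k d1 d2 (\<lambda>X. \<Phi> X + \<Psi> X) X = ampliation k d1 d2 \<Phi> X + ampliation k d1 d2 \<Psi> X"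
proof (intro eq_matI)
  fix p q
  assume "p < dim_row (ampliation k d1 d2 \<Phi> X + ampliation k d1 d2 \<Psi> X)"
    and "q < dim_col (ampliation k d1 d2 \<Phi> X + ampliation k d1 d2 \<Psi> X)"
  then have pq: "p < k * d2" "q < k * d2" by (auto simp: ampliation_def)
  let ?B = "block d1 X (p div d2) (q div d2)"
  have "\<Phi> ?B \<in> carrier_mat d2 d2" "\<Psi> ?B \<in> carrier_mat d2 d2" using assms by auto
  then show "ampliation k d1 d2 (\<lambda>X. \<Phi> X + \<Psi> X) X $$ (p, q)
      = (ampliation k d1 d2 \<Phi> X + ampliation k d1 d2 \<Psi> X) $$ (p, q)"
    using pq div_mod_block_index[OF pq(1)] div_mod_block_index[OF pq(2)]
    by (simp add: ampliation_def)
qed (auto simp: ampliation_def)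

lemma sum_block_index:
  fixes f :: "nat \<Rightarrow> 'a :: comm_monoid_add"
  shows "(\<Sum>p<k * d. f p) = (\<Sum>l<k. \<Sum>a<d. f (l * d + a))"
proof -
  have "(\<Sum>p<k * d. f p) = (\<Sum>l<k. sum f {l * d..<l * d + d})" by (rule sum.nat_group[symmetric])
  also have "\<dots> = (\<Sum>l<k. \<Sum>a<d. f (l * d + a))"
  proof (rule sum.cong[OF refl])
    fix l assume "l \<in> {..<k}"
    show "sum f {l * d..<l * d + d} = (\<Sum>a<d. f (l * d + a))"
      by (rule sum.reindex_bij_witness[of _ "\<lambda>a. l * d + a" "\<lambda>p. p - l * d"]) auto
  qed
  finally show ?thesis .
qed

text \<open>
  A conjugation acts on each block separately, which makes its ampliation the conjugation by
  \<open>1 \<otimes> T\<close>. Hence conjugations are completely positive, and both properties of an EB-map survive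
  them.
\<close>

lemma ampliation_Ad:
  assumes T: "T \<in> carrier_mat d d" and Y: "Y \<in> carrier_mat (k * d) (k * d)"
  shows "ampliation k d d (Ad T) Y = Ad (kron (1\<^sub>m k) T) Y"
proof (intro eq_matI)
  let ?V = "kron (1\<^sub>m k) T"
  have V: "?V \<in> carrier_mat (k * d) (k * d)" using T by (auto simp: kron_def)
  have AdV: "Ad ?V Y \<in> carrier_mat (k * d) (k * d)" using V Y by simp
  show "dim_row (ampliation k d d (Ad T) Y) = dim_row (Ad ?V Y)"
    and "dim_col (ampliation k d d (Ad T) Y) = dim_col (Ad ?V Y)"
    using AdV by (auto simp: ampliation_def)
  fix p q assume "p < dim_row (Ad ?V Y)" "q < dim_col (Ad ?V Y)"
  then have pq: "p < k * d" "q < k * d" using AdV by auto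
  define i a j b where "i = p div d" and "a = p mod d" and "j = q div d" and "b = q mod d"
  have ij: "i < k" "a < d" "j < k" "b < d"
    using div_mod_block_index pq by (auto simp: i_def a_def j_def b_def)
  have V_entry: "?V $$ (l * d + c, r) = (if l = r div d then T $$ (c, r mod d) else 0)"
    if "l < k" "c < d" "r < k * d" for l c r
    using that T block_index_less[of l k c d] div_mod_block_index[OF that(3)] by (auto simp: kron_def)
  have inner: "(\<Sum>r<k * d. cnj (?V $$ (r, p)) * Y $$ (r, s)) = (\<Sum>c<d. cnj (T $$ (c, a)) * Y $$ (i * d + c, s))" for s
  proof -
    have "(\<Sum>r<k * d. cnj (?V $$ (r, p)) * Y $$ (r, s))
        = (\<Sum>l<k. if l = i then \<Sum>c<d. cnj (T $$ (c, a)) * Y $$ (l * d + c, s) else 0)"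
      unfolding sum_block_index
      by (intro sum.cong refl) (auto simp: V_entry pq i_def a_def)
    then show ?thesis using ij by simp
  qed
  have "Ad ?V Y $$ (p, q)
      = (\<Sum>m<k. if m = j then \<Sum>e<d. (\<Sum>c<d. cnj (T $$ (c, a)) * Y $$ (i * d + c, m * d + e)) * T $$ (e, b) else 0)"
    unfolding Ad_index[OF V Y pq] inner
    unfolding sum_block_index
    by (intro sum.cong refl) (auto simp: V_entry pq j_def b_def)
  also have "\<dots> = (\<Sum>e<d. (\<Sum>c<d. cnj (T $$ (c, a)) * Y $$ (i * d + c, j * d + e)) * T $$ (e, b))"
    using ij by simp
  also have "\<dots> = Ad T (block d Y i j) $$ (a, b)"
    unfolding Ad_index[OF T block_carrier ij(2,4)] by (simp add: block_def)
  finally show "ampliation k d d (Ad T) Y $$ (p, q) = Ad ?V Y $$ (p, q)"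
    using pq by (simp add: ampliation_def i_def j_def a_def b_def)
qed

section \<open>Entanglement breaking maps\<close>

lemma kron_carrier:
  "A \<in> carrier_mat k k \<Longrightarrow> B \<in> carrier_mat d d \<Longrightarrow> kron A B \<in> carrier_mat (k * d) (k * d)"
  by (auto simp: kron_def)

lemma separable_mat_zero: "separable_mat k d (0\<^sub>m (k * d) (k * d))"
  by (auto simp: separable_mat_def psd_mat_zero intro!: exI[of _ "0 :: nat"])

lemma separable_mat_add:
  assumes X: "separable_mat k d X" and Y: "separable_mat k d Y"
  shows "separable_mat k d (X + Y)"
proof -
  obtain n A B where AB: "\<And>i. i < n \<Longrightarrow> psd_mat k (A i) \<and> psd_mat d (B i)"
      and X': "X = msum (k * d) (\<lambda>i. kron (A i) (B i)) {..<(n::nat)}"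
    using X by (auto simp: separable_mat_def)
  obtain m C D where CD: "\<And>i. i < m \<Longrightarrow> psd_mat k (C i) \<and> psd_mat d (D i)"
      and Y': "Y = msum (k * d) (\<lambda>i. kron (C i) (D i)) {..<(m::nat)}"
    using Y by (auto simp: separable_mat_def)
  define A' where "A' i = (if i < n then A i else C (i - n))" for i
  define B' where "B' i = (if i < n then B i else D (i - n))" for i
  have AB': "psd_mat k (A' i) \<and> psd_mat d (B' i)" if "i < n + m" for i
    using that AB CD by (auto simp: A'_def B'_def)
  have c: "kron (A' i) (B' i) \<in> carrier_mat (k * d) (k * d)" if "i < n + m" for i
    using AB'[OF that] by (intro kron_carrier) (auto simp: psd_mat_def)
  have cX: "kron (A i) (B i) \<in> carrier_mat (k * d) (k * d)" if "i < n" for i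
    using AB[OF that] by (intro kron_carrier) (auto simp: psd_mat_def)
  have cY: "kron (C i) (D i) \<in> carrier_mat (k * d) (k * d)" if "i < m" for i
    using CD[OF that] by (intro kron_carrier) (auto simp: psd_mat_def)
  have XY: "X \<in> carrier_mat (k * d) (k * d)" "Y \<in> carrier_mat (k * d) (k * d)"
    using X Y by (auto simp: separable_mat_def psd_mat_def)
  have "X + Y = msum (k * d) (\<lambda>i. kron (A' i) (B' i)) {..<n + m}" (is "_ = ?S")
  proof (intro eq_matI)
    have S: "?S \<in> carrier_mat (k * d) (k * d)" using c by (intro msum_carrier) auto
    then show "dim_row (X + Y) = dim_row ?S" "dim_col (X + Y) = dim_col ?S" using XY by auto
    fix p q assume "p < dim_row ?S" "q < dim_col ?S"
    then have pq: "p < k * d" "q < k * d" using S by auto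
    have "?S $$ (p, q) = (\<Sum>i<n + m. kron (A' i) (B' i) $$ (p, q))"
      using c pq by (subst msum_index) auto
    also have "\<dots> = (\<Sum>i<n. kron (A' i) (B' i) $$ (p, q)) + (\<Sum>i<m. kron (A' (n + i)) (B' (n + i)) $$ (p, q))"
      by (induction m) (auto simp: add.assoc)
    also have "\<dots> = X $$ (p, q) + Y $$ (p, q)"
    proof -
      have "X $$ (p, q) = (\<Sum>i<n. kron (A i) (B i) $$ (p, q))"
        unfolding X' using cX pq by (intro msum_index) auto
      moreover have "Y $$ (p, q) = (\<Sum>i<m. kron (C i) (D i) $$ (p, q))"
        unfolding Y' using cY pq by (intro msum_index) auto
      ultimately show ?thesis by (simp add: A'_def B'_def)
    qed
    finally show "(X + Y) $$ (p, q) = ?S $$ (p, q)" using pq XY by simp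
  qed
  moreover have "psd_mat (k * d) (X + Y)"
    using X Y by (auto simp: separable_mat_def intro!: psd_mat_add)
  ultimately show ?thesis using AB' unfolding separable_mat_def by blast
qed

text \<open>
  On an elementary tensor the ampliation of \<open>Ad T\<close> changes only the second factor, and it keeps that
  factor positive semidefinite; being itself a conjugation, it is additive over the tensors.
\<close>

lemma separable_mat_ampliation_Ad:
  assumes T: "T \<in> carrier_mat d d" and X: "separable_mat k d X"
  shows "separable_mat k d (ampliation k d d (Ad T) X)"
proof -
  let ?V = "kron (1\<^sub>m k) T"
  have V: "?V \<in> carrier_mat (k * d) (k * d)" using T by (intro kron_carrier) auto
  obtain n A B where AB: "\<And>i. i < n \<Longrightarrow> psd_mat k (A i) \<and> psd_mat d (B i)"
      and X': "X = msum (k * d) (\<lambda>i. kron (A i) (B i)) {..<(n::nat)}"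
    using X by (auto simp: separable_mat_def)
  have c: "A i \<in> carrier_mat k k" "B i \<in> carrier_mat d d" if "i < n" for i
    using AB[OF that] by (auto simp: psd_mat_def)
  have XC: "X \<in> carrier_mat (k * d) (k * d)" using X by (auto simp: separable_mat_def psd_mat_def)
  have eq: "ampliation k d d (Ad T) X = Ad ?V X" by (rule ampliation_Ad[OF T XC])
  also have "\<dots> = msum (k * d) (\<lambda>i. Ad ?V (kron (A i) (B i))) {..<n}"
    unfolding X' by (rule linear_mat_map_msum[OF linear_mat_map_Ad[OF V]]) (auto intro: kron_carrier c)
  also have "\<dots> = msum (k * d) (\<lambda>i. kron (A i) (Ad T (B i))) {..<n}"
  proof (rule msum_cong)
    fix i assume i: "i \<in> {..<n}"
    then show "kron (A i) (Ad T (B i)) \<in> carrier_mat (k * d) (k * d)"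
      using c T by (intro kron_carrier) auto
    have "Ad ?V (kron (A i) (B i)) = ampliation k d d (Ad T) (kron (A i) (B i))"
      using i c by (intro ampliation_Ad[OF T, symmetric] kron_carrier) auto
    then show "Ad ?V (kron (A i) (B i)) = kron (A i) (Ad T (B i))"
      using i c by (simp add: ampliation_kron[OF linear_mat_map_Ad[OF T]])
  qed auto
  finally have "ampliation k d d (Ad T) X = msum (k * d) (\<lambda>i. kron (A i) (Ad T (B i))) {..<n}" .
  moreover have "psd_mat (k * d) (ampliation k d d (Ad T) X)"
    unfolding eq using X by (intro psd_mat_Ad[OF V]) (auto simp: separable_mat_def)
  moreover have "\<forall>i<n. psd_mat k (A i) \<and> psd_mat d (Ad T (B i))"
    using AB psd_mat_Ad[OF T] by blast
  ultimately show ?thesis unfolding separable_mat_def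
    by (intro conjI exI[of _ n] exI[of _ A] exI[of _ "\<lambda>i. Ad T (B i)"])
qed

text \<open>Separability includes positivity, so complete positivity need not be checked separately.\<close>

lemma eb_mapI:
  assumes "linear_mat_map d1 d2 \<Phi>"
    and "\<And>k X. 1 \<le> k \<Longrightarrow> psd_mat (k * d1) X \<Longrightarrow> separable_mat k d2 (ampliation k d1 d2 \<Phi> X)"
  shows "eb_map d1 d2 \<Phi>"
  using assms by (auto simp: eb_map_def completely_positive_def separable_mat_def)

lemma eb_mapD:
  assumes "eb_map d1 d2 \<Phi>"
  shows "linear_mat_map d1 d2 \<Phi>"
    and "1 \<le> k \<Longrightarrow> psd_mat (k * d1) X \<Longrightarrow> separable_mat k d2 (ampliation k d1 d2 \<Phi> X)"
  using assms by (auto simp: eb_map_def completely_positive_def)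

lemma eb_map_carrier:
  "eb_map d1 d2 \<Phi> \<Longrightarrow> X \<in> carrier_mat d1 d1 \<Longrightarrow> \<Phi> X \<in> carrier_mat d2 d2"
  using eb_mapD(1) linear_mat_mapD(1) by blast

lemma eb_map_cong:
  assumes \<Phi>: "eb_map d1 d2 \<Phi>" and eq: "\<And>X. X \<in> carrier_mat d1 d1 \<Longrightarrow> \<Psi> X = \<Phi> X"
  shows "eb_map d1 d2 \<Psi>"
proof (rule eb_mapI)
  show "linear_mat_map d1 d2 \<Psi>"
    using eb_mapD(1)[OF \<Phi>] eq by (simp add: linear_mat_map_def)
  show "separable_mat k d2 (ampliation k d1 d2 \<Psi> X)" if "1 \<le> k" "psd_mat (k * d1) X" for k X
    using eb_mapD(2)[OF \<Phi> that] ampliation_cong[of d1 \<Psi> \<Phi> k d2 X] eq by simp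
qed

lemma eb_map_zero: "eb_map d1 d2 (\<lambda>_. 0\<^sub>m d2 d2)"
proof (rule eb_mapI)
  show "linear_mat_map d1 d2 (\<lambda>_. 0\<^sub>m d2 d2)"
    by (auto simp: linear_mat_map_def intro!: eq_matI)
  show "separable_mat k d2 (ampliation k d1 d2 (\<lambda>_. 0\<^sub>m d2 d2) X)" for k X
  proof -
    have "ampliation k d1 d2 (\<lambda>_. 0\<^sub>m d2 d2) X = 0\<^sub>m (k * d2) (k * d2)"
      by (intro eq_matI) (auto simp: ampliation_def div_mod_block_index)
    then show ?thesis using separable_mat_zero by simp
  qed
qed

lemma eb_map_add:
  assumes \<Phi>: "eb_map d1 d2 \<Phi>" and \<Psi>: "eb_map d1 d2 \<Psi>"
  shows "eb_map d1 d2 (\<lambda>X. \<Phi> X + \<Psi> X)"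
proof (rule eb_mapI)
  note c = eb_map_carrier[OF \<Phi>] eb_map_carrier[OF \<Psi>]
  note l = linear_mat_mapD[OF eb_mapD(1)[OF \<Phi>]] linear_mat_mapD[OF eb_mapD(1)[OF \<Psi>]]
  have "\<Phi> (X + Y) + \<Psi> (X + Y) = (\<Phi> X + \<Psi> X) + (\<Phi> Y + \<Psi> Y)"
    if XY: "X \<in> carrier_mat d1 d1" "Y \<in> carrier_mat d1 d1" for X Y
    unfolding l(2)[OF XY] l(5)[OF XY] using c[OF XY(1)] c[OF XY(2)] by (intro eq_matI) auto
  moreover have "\<Phi> (a \<cdot>\<^sub>m X) + \<Psi> (a \<cdot>\<^sub>m X) = a \<cdot>\<^sub>m (\<Phi> X + \<Psi> X)"
    if X: "X \<in> carrier_mat d1 d1" for a X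
    unfolding l(3)[OF X] l(6)[OF X] using c[OF X]
    by (intro add_smult_distrib_left_mat[symmetric, of _ d2 d2])
  ultimately show "linear_mat_map d1 d2 (\<lambda>X. \<Phi> X + \<Psi> X)"
    using c by (auto simp: linear_mat_map_def)
  show "separable_mat k d2 (ampliation k d1 d2 (\<lambda>X. \<Phi> X + \<Psi> X) X)"
    if "1 \<le> k" "psd_mat (k * d1) X" for k X
    using ampliation_add[of d1 \<Phi> d2 \<Psi> k X] c
      separable_mat_add[OF eb_mapD(2)[OF \<Phi> that] eb_mapD(2)[OF \<Psi> that]]
    by simp
qed

lemma eb_map_Ad:
  assumes \<Phi>: "eb_map d1 d2 \<Phi>" and T: "T \<in> carrier_mat d2 d2"
  shows "eb_map d1 d2 (\<lambda>X. Ad T (\<Phi> X))"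
proof (rule eb_mapI)
  show "linear_mat_map d1 d2 (\<lambda>X. Ad T (\<Phi> X))"
    using eb_mapD(1)[OF \<Phi>] T by (simp add: linear_mat_map_def Ad_add Ad_scale)
  show "separable_mat k d2 (ampliation k d1 d2 (\<lambda>X. Ad T (\<Phi> X)) X)"
    if "1 \<le> k" "psd_mat (k * d1) X" for k X
    using ampliation_compose[of d1 \<Phi> d2 k d2 "Ad T" X] eb_map_carrier[OF \<Phi>]
      separable_mat_ampliation_Ad[OF T eb_mapD(2)[OF \<Phi> that]]
    by simp
qed

lemma eb_map_msum:
  assumes "finite I" "\<And>i. i \<in> I \<Longrightarrow> eb_map d1 d2 (\<Phi> i)"
  shows "eb_map d1 d2 (\<lambda>X. msum d2 (\<lambda>i. \<Phi> i X) I)"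
  using assms
proof (induction I rule: finite_induct)
  case empty
  then show ?case by (simp add: eb_map_zero)
next
  case (insert i I)
  have "eb_map d1 d2 (\<lambda>X. \<Phi> i X + msum d2 (\<lambda>i. \<Phi> i X) I)"
    using insert by (intro eb_map_add) auto
  then show ?case
  proof (rule eb_map_cong)
    fix X :: "complex mat" assume X: "X \<in> carrier_mat d1 d1"
    show "msum d2 (\<lambda>i. \<Phi> i X) (insert i I) = \<Phi> i X + msum d2 (\<lambda>i. \<Phi> i X) I"
      using insert X by (intro msum_insert) (auto intro: eb_map_carrier)
  qed
qed

text \<open>This is complete positivity for a single block.\<close>

lemma eb_map_one_psd:
  assumes \<Phi>: "eb_map d1 d2 \<Phi>"
  shows "psd_mat d2 (\<Phi> (1\<^sub>m d1))"
proof -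
  have "block d1 (1\<^sub>m d1) 0 0 = 1\<^sub>m d1" by (intro eq_matI) (auto simp: block_def)
  then have "ampliation 1 d1 d2 \<Phi> (1\<^sub>m d1) = \<Phi> (1\<^sub>m d1)"
    using eb_map_carrier[OF \<Phi>, of "1\<^sub>m d1"] by (intro eq_matI) (auto simp: ampliation_def)
  then show ?thesis
    using eb_mapD(2)[OF \<Phi>, of 1 "1\<^sub>m d1"] psd_mat_one[of d1] by (simp add: separable_mat_def)
qed

text \<open>
  Every EB-map with invertible value at the identity is a conjugate of a unital one: a factorization
  \<open>\<Theta>(I) = T\<^sup>*T\<close> forces \<open>T\<close> to be invertible, and conjugation by \<open>T\<^sup>-\<^sup>1\<close> turns \<open>\<Theta>(I)\<close> into \<open>I\<close>.
\<close>

lemma eb_map_normalize: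
  assumes \<Theta>: "eb_map d1 d2 \<Theta>" and inv: "invertible_mat (\<Theta> (1\<^sub>m d1))"
  obtains T \<Phi> where "T \<in> carrier_mat d2 d2" "invertible_mat T" "mat_adjoint T * T = \<Theta> (1\<^sub>m d1)"
    "\<Phi> \<in> UEB d1 d2" "\<And>X. X \<in> carrier_mat d1 d1 \<Longrightarrow> \<Theta> X = Ad T (\<Phi> X)"
proof -
  have \<Theta>1: "\<Theta> (1\<^sub>m d1) \<in> carrier_mat d2 d2" using eb_map_carrier[OF \<Theta>] by simp
  obtain T where T: "T \<in> carrier_mat d2 d2" "mat_adjoint T * T = \<Theta> (1\<^sub>m d1)"
    using psd_mat_factorization[OF eb_map_one_psd[OF \<Theta>]] .
  note T' = mat_adjoint_carrier[OF T(1)]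
  obtain R where R: "R \<in> carrier_mat d2 d2" "R * (mat_adjoint T * T) = 1\<^sub>m d2"
    using invertible_matD[OF inv \<Theta>1] unfolding T(2) by metis
  have "(R * mat_adjoint T) * T = 1\<^sub>m d2"
    using R(2) assoc_mult_mat[OF R(1) T' T(1)] by simp
  then have invT: "invertible_mat T"
    by (rule invertible_matI[OF mult_carrier_mat[OF R(1) T'] T(1)])
  obtain S where S: "S \<in> carrier_mat d2 d2" "S * T = 1\<^sub>m d2" "T * S = 1\<^sub>m d2"
    using invertible_matD[OF invT T(1)] .
  have "Ad S (\<Theta> (1\<^sub>m d1)) = Ad S (Ad T (1\<^sub>m d2))" by (simp add: Ad_of_one[OF T(1)] T(2))
  also have "\<dots> = 1\<^sub>m d2" using S T(1) by (simp add: Ad_Ad)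
  finally have "(\<lambda>X. Ad S (\<Theta> X)) \<in> UEB d1 d2"
    using eb_map_Ad[OF \<Theta> S(1)] by (simp add: UEB_def)
  moreover have "\<Theta> X = Ad T (Ad S (\<Theta> X))" if "X \<in> carrier_mat d1 d1" for X
    using S T(1) eb_map_carrier[OF \<Theta> that] by (simp add: Ad_Ad)
  ultimately show ?thesis using that T invT by blast
qed

section \<open>The characterization of extreme points\<close>

lemma msum_lessThan_two:
  assumes "f 0 \<in> carrier_mat n n" "f 1 \<in> carrier_mat n n"
  shows "msum n f {..<2 :: nat} = f 0 + f 1"
proof -
  have "{..<2 :: nat} = {0, 1}" by auto
  moreover have "msum n f {0, 1} = f 0 + msum n f {1}"
    using assms by (intro msum_insert) auto
  moreover have "msum n f {1} = f 1 + msum n f {}"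
    using assms by (intro msum_insert) auto
  ultimately show ?thesis using assms(2) by simp
qed

lemma invertible_mat_adjoint:
  fixes T :: "complex mat"
  assumes T: "T \<in> carrier_mat n n" "invertible_mat T"
  shows "invertible_mat (mat_adjoint T)"
proof -
  obtain S where S: "S \<in> carrier_mat n n" "T * S = 1\<^sub>m n" using invertible_matD[OF T(2,1)] by metis
  have "mat_adjoint S * mat_adjoint T = 1\<^sub>m n"
    unfolding mat_adjoint_mult[OF T(1) S(1), symmetric] S(2) by simp
  then show ?thesis
    by (rule invertible_matI[OF mat_adjoint_carrier[OF S(1)] mat_adjoint_carrier[OF T(1)]])
qed

text \<open>The difference is the sum of the remaining terms, possibly the empty sum.\<close>

lemma eb_le_msum_term:
  assumes "finite I" "i \<in> I" and \<Psi>: "\<And>j. j \<in> I \<Longrightarrow> eb_map d1 d2 (\<Psi> j)"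
    and sum: "\<And>X. X \<in> carrier_mat d1 d1 \<Longrightarrow> \<Phi> X = msum d2 (\<lambda>j. \<Psi> j X) I"
  shows "eb_le d1 d2 (\<Psi> i) \<Phi>"
  unfolding eb_le_def
proof (rule eb_map_cong)
  let ?J = "I - {i}"
  show "eb_map d1 d2 (\<lambda>X. msum d2 (\<lambda>j. \<Psi> j X) ?J)"
    using assms by (intro eb_map_msum) auto
  fix X :: "complex mat" assume X: "X \<in> carrier_mat d1 d1"
  have c: "\<Psi> j X \<in> carrier_mat d2 d2" if "j \<in> I" for j using eb_map_carrier[OF \<Psi>[OF that] X] .
  have "\<Phi> X = msum d2 (\<lambda>j. \<Psi> j X) (insert i ?J)"
    using sum[OF X] \<open>i \<in> I\<close> by (simp add: insert_absorb)
  also have "\<dots> = \<Psi> i X + msum d2 (\<lambda>j. \<Psi> j X) ?J"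
    using assms c by (intro msum_insert) auto
  finally have \<Phi>X: "\<Phi> X = \<Psi> i X + msum d2 (\<lambda>j. \<Psi> j X) ?J" .
  have "msum d2 (\<lambda>j. \<Psi> j X) ?J \<in> carrier_mat d2 d2"
    using assms c by (intro msum_carrier) auto
  then show "\<Phi> X - \<Psi> i X = msum d2 (\<lambda>j. \<Psi> j X) ?J"
    unfolding \<Phi>X using c[OF \<open>i \<in> I\<close>] by (intro eq_matI) auto
qed

text \<open>
  Two factors of the same positive definite matrix differ by a unitary from the left.
\<close>

lemma unitary_of_equal_gram:
  assumes T: "T \<in> carrier_mat n n" and S: "S \<in> carrier_mat n n" "T * S = 1\<^sub>m n"
    and Z: "Z \<in> carrier_mat n n" and gram: "mat_adjoint Z * Z = mat_adjoint T * T"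
  shows "unitary_mat n (Z * S)"
proof -
  have ZS: "Z * S \<in> carrier_mat n n" using Z S by simp
  have "mat_adjoint (Z * S) * (Z * S) = Ad S (Ad Z (1\<^sub>m n))"
    by (simp add: Ad_Ad[OF S(1) Z] Ad_of_one[OF ZS])
  also have "\<dots> = Ad S (Ad T (1\<^sub>m n))" by (simp add: Ad_of_one[OF Z] Ad_of_one[OF T] gram)
  also have "\<dots> = 1\<^sub>m n" by (simp add: Ad_Ad[OF S(1) T] S(2))
  finally have *: "mat_adjoint (Z * S) * (Z * S) = 1\<^sub>m n" .
  show ?thesis
    using * mat_mult_left_right_inverse[OF mat_adjoint_carrier[OF ZS] ZS *] ZS
    by (simp add: unitary_mat_def)
qed

lemma unitary_mat_invertible: "unitary_mat n U \<Longrightarrow> invertible_mat U"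
  using invertible_matI[of "mat_adjoint U" n U] by (auto simp: unitary_mat_def)

text \<open>
  Halving \<open>\<Psi>\<close> is what makes the value of the complement at the identity invertible. The halving is
  itself written as the conjugation by \<open>H = I/\<surd>2\<close>, so that \<open>eb_map_Ad\<close> applies to it.
\<close>

lemma cstar_extreme_imp_dominated_conjugate:
  assumes ext: "cstar_extreme_UEB d1 d2 \<Phi>" and \<Psi>: "eb_map d1 d2 \<Psi>"
    and le: "eb_le d1 d2 \<Psi> \<Phi>" and inv: "invertible_mat (\<Psi> (1\<^sub>m d1))"
  shows "\<exists>Z \<in> carrier_mat d2 d2. invertible_mat Z \<and>
    (\<forall>X \<in> carrier_mat d1 d1. \<Psi> X = Ad Z (\<Phi> X))"
proof -
  have \<Phi>: "eb_map d1 d2 \<Phi>" and \<Phi>1: "\<Phi> (1\<^sub>m d1) = 1\<^sub>m d2"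
    using ext by (auto simp: cstar_extreme_UEB_def UEB_def)
  have diff: "eb_map d1 d2 (\<lambda>X. \<Phi> X - \<Psi> X)" using le by (simp add: eb_le_def)
  note c = eb_map_carrier[OF \<Phi>] eb_map_carrier[OF \<Psi>]
  define H where "H = complex_of_real (1 / sqrt 2) \<cdot>\<^sub>m 1\<^sub>m d2"
  have H: "H \<in> carrier_mat d2 d2" by (simp add: H_def)
  have Ad_H: "Ad H X = complex_of_real (1 / 2) \<cdot>\<^sub>m X" if X: "X \<in> carrier_mat d2 d2" for X
  proof -
    have "complex_of_real (1 / sqrt 2) * cnj (complex_of_real (1 / sqrt 2)) = complex_of_real (1 / 2)"
      unfolding complex_cnj_complex_of_real of_real_mult[symmetric] by simp
    then show ?thesis
      unfolding H_def Ad_smult[OF one_carrier_mat X] by (simp only: Ad_one[OF X])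
  qed
  define \<Theta> where "\<Theta> X = Ad H (\<Psi> X)" for X
  \<comment> \<open>\<open>\<Xi>\<close> is \<open>\<Phi> - \<Psi>/2\<close>, in a form that exhibits it as a sum of EB-maps.\<close>
  define \<Xi> where "\<Xi> X = Ad H (\<Phi> X) + Ad H (\<Phi> X - \<Psi> X)" for X
  have \<Theta>: "eb_map d1 d2 \<Theta>" unfolding \<Theta>_def by (rule eb_map_Ad[OF \<Psi> H])
  have \<Xi>: "eb_map d1 d2 \<Xi>"
    unfolding \<Xi>_def by (rule eb_map_add[OF eb_map_Ad[OF \<Phi> H] eb_map_Ad[OF diff H]])
  have split: "\<Theta> X + \<Xi> X = \<Phi> X" if X: "X \<in> carrier_mat d1 d1" for X
  proof -
    have D: "\<Phi> X - \<Psi> X \<in> carrier_mat d2 d2" using eb_map_carrier[OF diff X] .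
    show ?thesis
      unfolding \<Theta>_def \<Xi>_def Ad_H[OF c(1)[OF X]] Ad_H[OF c(2)[OF X]] Ad_H[OF D]
      using c[OF X] by (intro eq_matI) (auto simp: algebra_simps)
  qed
  have one: "1\<^sub>m d1 \<in> carrier_mat d1 d1" by simp
  have "invertible_mat (\<Theta> (1\<^sub>m d1))"
    unfolding \<Theta>_def Ad_H[OF c(2)[OF one]] by (intro invertible_mat_smult[OF c(2)[OF one] inv]) simp
  then obtain T \<Phi>\<^sub>0 where T: "T \<in> carrier_mat d2 d2" "invertible_mat T" "mat_adjoint T * T = \<Theta> (1\<^sub>m d1)"
      and \<Phi>0: "\<Phi>\<^sub>0 \<in> UEB d1 d2" "\<And>X. X \<in> carrier_mat d1 d1 \<Longrightarrow> \<Theta> X = Ad T (\<Phi>\<^sub>0 X)"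
    using eb_map_normalize[OF \<Theta>] by metis
  have "psd_mat d2 (Ad H (\<Phi> (1\<^sub>m d1) - \<Psi> (1\<^sub>m d1)))"
    using psd_mat_Ad[OF H eb_map_one_psd[OF diff]] .
  moreover have "\<Xi> (1\<^sub>m d1) = complex_of_real (1 / 2) \<cdot>\<^sub>m 1\<^sub>m d2 + Ad H (\<Phi> (1\<^sub>m d1) - \<Psi> (1\<^sub>m d1))"
    unfolding \<Xi>_def \<Phi>1 Ad_H[OF one_carrier_mat] ..
  ultimately have "invertible_mat (\<Xi> (1\<^sub>m d1))"
    using invertible_scalar_plus_psd[of d2 _ "1 / 2"] by simp
  then obtain R \<Phi>\<^sub>1 where R: "R \<in> carrier_mat d2 d2" "invertible_mat R" "mat_adjoint R * R = \<Xi> (1\<^sub>m d1)"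
      and \<Phi>1': "\<Phi>\<^sub>1 \<in> UEB d1 d2" "\<And>X. X \<in> carrier_mat d1 d1 \<Longrightarrow> \<Xi> X = Ad R (\<Phi>\<^sub>1 X)"
    using eb_map_normalize[OF \<Xi>] by metis
  define V where "V i = (if i = 0 then T else R)" for i :: nat
  define \<Omega> where "\<Omega> i = (if i = 0 then \<Phi>\<^sub>0 else \<Phi>\<^sub>1)" for i :: nat
  have "\<forall>i<2. V i \<in> carrier_mat d2 d2 \<and> invertible_mat (V i) \<and> \<Omega> i \<in> UEB d1 d2"
    using T R \<Phi>0 \<Phi>1' by (simp add: V_def \<Omega>_def)
  moreover have "msum d2 (\<lambda>i. mat_adjoint (V i) * V i) {..<2} = 1\<^sub>m d2"
    using T R split[OF one] \<Phi>1 eb_map_carrier[OF \<Theta> one] eb_map_carrier[OF \<Xi> one]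
    by (subst msum_lessThan_two) (simp_all add: V_def)
  moreover have "\<forall>X \<in> carrier_mat d1 d1. \<Phi> X = msum d2 (\<lambda>i. Ad (V i) (\<Omega> i X)) {..<2}"
  proof
    fix X :: "complex mat" assume X: "X \<in> carrier_mat d1 d1"
    show "\<Phi> X = msum d2 (\<lambda>i. Ad (V i) (\<Omega> i X)) {..<2}"
      using split[OF X] \<Phi>0(2)[OF X] \<Phi>1'(2)[OF X] eb_map_carrier[OF \<Theta> X] eb_map_carrier[OF \<Xi> X]
      by (subst msum_lessThan_two) (simp_all add: V_def \<Omega>_def)
  qed
  ultimately have "\<exists>U. \<forall>i<2. unitary_mat d2 (U i) \<and>
      (\<forall>X \<in> carrier_mat d1 d1. \<Omega> i X = Ad (U i) (\<Phi> X))"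
    by (intro ext[unfolded cstar_extreme_UEB_def, THEN conjunct2, THEN spec[of _ 2],
          THEN spec[of _ V], THEN spec[of _ \<Omega>], THEN mp] conjI)
  then obtain U where U: "\<forall>i<2. unitary_mat d2 (U i) \<and>
      (\<forall>X \<in> carrier_mat d1 d1. \<Omega> i X = Ad (U i) (\<Phi> X))" ..
  then have U0: "unitary_mat d2 (U 0)" "\<And>X. X \<in> carrier_mat d1 d1 \<Longrightarrow> \<Phi>\<^sub>0 X = Ad (U 0) (\<Phi> X)"
    by (auto simp: \<Omega>_def dest!: spec[of _ 0])
  have U0': "U 0 \<in> carrier_mat d2 d2" using U0(1) by (simp add: unitary_mat_def)
  define Z where "Z = complex_of_real (sqrt 2) \<cdot>\<^sub>m (U 0 * T)"
  have "Z \<in> carrier_mat d2 d2" using U0' T(1) by (simp add: Z_def)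
  moreover have "invertible_mat Z"
    unfolding Z_def using U0' T unitary_mat_invertible[OF U0(1)]
    by (intro invertible_mat_smult invertible_mat_mult) auto
  moreover have "\<Psi> X = Ad Z (\<Phi> X)" if X: "X \<in> carrier_mat d1 d1" for X
  proof -
    have two: "complex_of_real (sqrt 2) * cnj (complex_of_real (sqrt 2)) = 2"
      unfolding complex_cnj_complex_of_real of_real_mult[symmetric] by simp
    have "Ad Z (\<Phi> X) = 2 \<cdot>\<^sub>m Ad (U 0 * T) (\<Phi> X)"
      unfolding Z_def Ad_smult[OF mult_carrier_mat[OF U0' T(1)] c(1)[OF X]] two ..
    also have "\<dots> = 2 \<cdot>\<^sub>m \<Theta> X"
      by (simp add: \<Phi>0(2)[OF X] U0(2)[OF X] Ad_Ad[OF T(1) U0' c(1)[OF X]])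
    also have "\<dots> = \<Psi> X"
      unfolding \<Theta>_def Ad_H[OF c(2)[OF X]] using c(2)[OF X] by (intro eq_matI) auto
    finally show ?thesis by simp
  qed
  ultimately show ?thesis by blast
qed

text \<open>
  Each term of a decomposition is dominated by \<open>\<Phi>\<close> and has the invertible value \<open>T\<^sub>i\<^sup>*T\<^sub>i\<close> at the
  identity, so the hypothesis applies to it.
\<close>

lemma dominated_conjugate_imp_cstar_extreme:
  assumes \<Phi>: "\<Phi> \<in> UEB d1 d2"
    and dom: "\<And>\<Psi>. eb_map d1 d2 \<Psi> \<Longrightarrow> eb_le d1 d2 \<Psi> \<Phi> \<Longrightarrow> invertible_mat (\<Psi> (1\<^sub>m d1)) \<Longrightarrow>
      \<exists>Z \<in> carrier_mat d2 d2. invertible_mat Z \<and> (\<forall>X \<in> carrier_mat d1 d1. \<Psi> X = Ad Z (\<Phi> X))"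
  shows "cstar_extreme_UEB d1 d2 \<Phi>"
  unfolding cstar_extreme_UEB_def
proof (intro conjI allI impI \<Phi>; elim conjE)
  fix n :: nat and T \<Phi>s
  assume T\<Phi>: "\<forall>i<n. T i \<in> carrier_mat d2 d2 \<and> invertible_mat (T i) \<and> \<Phi>s i \<in> UEB d1 d2"
    and sum: "\<forall>X \<in> carrier_mat d1 d1. \<Phi> X = msum d2 (\<lambda>i. Ad (T i) (\<Phi>s i X)) {..<n}"
  have \<Phi>_eb: "eb_map d1 d2 \<Phi>" and \<Phi>_one: "\<Phi> (1\<^sub>m d1) = 1\<^sub>m d2" using \<Phi> by (auto simp: UEB_def)
  have eb: "eb_map d1 d2 (\<lambda>X. Ad (T j) (\<Phi>s j X))" if "j \<in> {..<n}" for j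
    using T\<Phi> that by (intro eb_map_Ad) (auto simp: UEB_def)
  have "\<exists>U. unitary_mat d2 U \<and> (\<forall>X \<in> carrier_mat d1 d1. \<Phi>s i X = Ad U (\<Phi> X))" if i: "i < n" for i
  proof -
    have T: "T i \<in> carrier_mat d2 d2" "invertible_mat (T i)"
      and \<Phi>i: "eb_map d1 d2 (\<Phi>s i)" "\<Phi>s i (1\<^sub>m d1) = 1\<^sub>m d2"
      using T\<Phi> i by (auto simp: UEB_def)
    obtain S where S: "S \<in> carrier_mat d2 d2" "T i * S = 1\<^sub>m d2"
      using invertible_matD[OF T(2,1)] by metis
    have "eb_le d1 d2 (\<lambda>X. Ad (T i) (\<Phi>s i X)) \<Phi>"
      using i sum eb by (intro eb_le_msum_term[of "{..<n}" i]) auto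
    moreover have "invertible_mat (Ad (T i) (\<Phi>s i (1\<^sub>m d1)))"
      unfolding \<Phi>i(2) Ad_of_one[OF T(1)]
      by (rule invertible_mat_mult[OF mat_adjoint_carrier[OF T(1)] invertible_mat_adjoint[OF T] T])
    ultimately have "\<exists>Z \<in> carrier_mat d2 d2. invertible_mat Z \<and>
        (\<forall>X \<in> carrier_mat d1 d1. Ad (T i) (\<Phi>s i X) = Ad Z (\<Phi> X))"
      using i by (intro dom eb) auto
    then obtain Z where Z: "Z \<in> carrier_mat d2 d2"
        "\<And>X. X \<in> carrier_mat d1 d1 \<Longrightarrow> Ad (T i) (\<Phi>s i X) = Ad Z (\<Phi> X)"
      by blast
    have "mat_adjoint Z * Z = mat_adjoint (T i) * T i"
      using Z(2)[of "1\<^sub>m d1"] by (simp add: \<Phi>_one \<Phi>i(2) Ad_of_one[OF Z(1)] Ad_of_one[OF T(1)])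
    then have "unitary_mat d2 (Z * S)" by (rule unitary_of_equal_gram[OF T(1) S Z(1)])
    moreover have "\<Phi>s i X = Ad (Z * S) (\<Phi> X)" if X: "X \<in> carrier_mat d1 d1" for X
    proof -
      have "\<Phi>s i X = Ad S (Ad (T i) (\<Phi>s i X))"
        using eb_map_carrier[OF \<Phi>i(1) X] S T(1) by (simp add: Ad_Ad)
      also have "\<dots> = Ad (Z * S) (\<Phi> X)"
        unfolding Z(2)[OF X] by (rule Ad_Ad[OF S(1) Z(1) eb_map_carrier[OF \<Phi>_eb X]])
      finally show ?thesis .
    qed
    ultimately show ?thesis by blast
  qed
  then show "\<exists>U. \<forall>i<n. unitary_mat d2 (U i) \<and> (\<forall>X \<in> carrier_mat d1 d1. \<Phi>s i X = Ad (U i) (\<Phi> X))"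
    by metis
qed

theorem theorem5p1:
  fixes d1 d2 :: nat and \<Phi> :: "complex mat \<Rightarrow> complex mat"
  assumes "1 \<le> d1" and "1 \<le> d2" and "\<Phi> \<in> UEB d1 d2"
  shows "cstar_extreme_UEB d1 d2 \<Phi> \<longleftrightarrow>
    (\<forall>\<Psi>. eb_map d1 d2 \<Psi> \<and> eb_le d1 d2 \<Psi> \<Phi> \<and> invertible_mat (\<Psi> (1\<^sub>m d1)) \<longrightarrow>
       (\<exists>Z \<in> carrier_mat d2 d2. invertible_mat Z \<and>
          (\<forall>X \<in> carrier_mat d1 d1. \<Psi> X = Ad Z (\<Phi> X))))"
  using cstar_extreme_imp_dominated_conjugate[of d1 d2 \<Phi>]
    dominated_conjugate_imp_cstar_extreme[OF assms(3)]
  by blast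

end
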